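(* Let $a$, $b$, $n$ be complex parameters with $n\notin\{0,-1,-2,\ldots\}$ and $2n\notin\{0,-1,-2,\ldots\}$, and let $$ f(n)=\sum_{k=0}^{\infty}\frac{(a)_k\,(b)_k}{(n)_k\,(2n)_k}. $$ If the series $f(n)$ and $f(n+1)$ converge, and $(a+b-3n-1)(a+b-3n)(a+b-3n+1)\neq 0$, then the recursion $$ f(n)=g_1(n)+g_2(n)\,f(n+1) $$ holds, where $$ g_2(n) = -\frac{(a-2n-1)(a-2n)(a-n)(b-2n-1)(b-2n)(b-n)}{2n^2(2n+1)(a+b-3n-1)(a+b-3n)(a+b-3n+1)} $$ and $$ g_1(n) = -\frac{N(a,b,n)}{2\,n\,(a+b-3n-1)(a+b-3n)(a+b-3n+1)}, $$ with $$ N(a,b,n) = a n\bigl(2-b(2+5b)+6n+27bn-38n^2\bigr) + a^2\bigl(b^2-5bn+2n(-1+4n)\bigr) + 2n\Bigl(b+b(3-19n)n+b^2(-1+4n)+n\bigl(-3+n(-2+23n)\bigr)\Bigr). $$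
   Context: For a complex number $x$ and an integer $k\ge 0$, $(x)_k = x(x+1)\cdots(x+k-1)$ denotes the Pochhammer symbol (rising factorial), with $(x)_0=1$. Here $f(n+1)$ is the same series with $n$ replaced by $n+1$ everywhere (so $2n$ becomes $2n+2$) and with $a,b$ unchanged, i.e. $f(n+1)=\sum_{k\ge 0}(a)_k(b)_k/\bigl((n+1)_k(2n+2)_k\bigr)$. *)

theory Defs
  imports "HOL-Analysis.Analysis"
begin

definition f_term :: "complex \<Rightarrow> complex \<Rightarrow> complex \<Rightarrow> nat \<Rightarrow> complex" where
  "f_term a b n k = (pochhammer a k * pochhammer b k) / (pochhammer n k * pochhammer (2 * n) k)"

(* Without summability, suminf has no meaningful value, so statements about f
   should assume "summable (f_term a b n)". There is no k! in the denominator of the terms. *)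
definition f :: "complex \<Rightarrow> complex \<Rightarrow> complex \<Rightarrow> complex" where
  "f a b n = (\<Sum>k. f_term a b n k)"

definition N :: "complex \<Rightarrow> complex \<Rightarrow> complex \<Rightarrow> complex" where
  "N a b n =
     a * n * (2 - b * (2 + 5 * b) + 6 * n + 27 * b * n - 38 * n\<^sup>2)
     + a\<^sup>2 * (b\<^sup>2 - 5 * b * n + 2 * n * (- 1 + 4 * n))
     + 2 * n * (b + b * (3 - 19 * n) * n + b\<^sup>2 * (- 1 + 4 * n) + n * (- 3 + n * (- 2 + 23 * n)))"

definition g1 :: "complex \<Rightarrow> complex \<Rightarrow> complex \<Rightarrow> complex" where
  "g1 a b n =
     - (N a b n / (2 * n * (a + b - 3 * n - 1) * (a + b - 3 * n) * (a + b - 3 * n + 1)))"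

definition g2 :: "complex \<Rightarrow> complex \<Rightarrow> complex \<Rightarrow> complex" where
  "g2 a b n =
     - (((a - 2 * n - 1) * (a - 2 * n) * (a - n) * (b - 2 * n - 1) * (b - 2 * n) * (b - n))
        / (2 * n\<^sup>2 * (2 * n + 1) * (a + b - 3 * n - 1) * (a + b - 3 * n) * (a + b - 3 * n + 1)))"

end

theory Submission
  imports Defs
begin

text \<open>
  The recursion is a telescoping identity in the style of Gosper and Zeilberger. Write
  \<open>t k\<close> for the terms of \<open>f(n)\<close> and \<open>t' k\<close> for those of \<open>f(n + 1)\<close>. Since \<open>t (k + 1) / t k\<close> and
  \<open>t' k / t k\<close> are rational in \<open>k\<close>, one can look for a rational \<open>R\<close> such that \<open>G k = R k * t k\<close>
  satisfies \<open>G (k + 1) - G k = t k - g2 * t' k\<close>. The choice \<open>R k = P k / (2n + k)\<close> with \<open>P\<close>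
  quadratic turns this into a cubic polynomial identity in \<open>k\<close>, that is, four linear equations for
  the three coefficients of \<open>P\<close> and for \<open>g2\<close>. The system is triangular with pivots
  \<open>a + b - 3n + 1\<close>, \<open>a + b - 3n\<close> and \<open>a + b - 3n - 1\<close>, which is where the nonvanishing condition
  comes from (\<open>gosper_equation\<close>). Summing over \<open>k\<close> gives \<open>f(n) - g2 * f(n + 1) = lim G - G 0\<close>,
  and \<open>- G 0 = - P 0 / (2n)\<close> is \<open>g1\<close>.

  What remains is \<open>lim G = 0\<close>. The limit of \<open>G\<close> exists because both series converge, and \<open>R k\<close>
  grows like a nonzero multiple of \<open>k\<close> (\<open>gosper_poly_asymptotics\<close>), so
  \<open>k * t k\<close> has a limit as well. A nonzero limit would make \<open>t k\<close> comparable to the terms of the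
  harmonic series and contradict convergence (\<open>summable_imp_lim_n_mult_eq_0\<close>).
\<close>

text \<open>
  If \<open>L\<close> is nonzero, dividing the terms by it makes their real parts eventually at least
  \<open>1 / (2 k)\<close>, so the real part of the rescaled series dominates half the harmonic series. This
  covers conditionally convergent series too, because the existence of the limit fixes the argument
  of the terms asymptotically.
\<close>
lemma summable_imp_lim_n_mult_eq_0:
  fixes u :: "nat \<Rightarrow> complex"
  assumes "summable u" and lim: "(\<lambda>k. of_nat k * u k) \<longlonglongrightarrow> L"
  shows "L = 0"
proof (rule ccontr)
  assume L: "L \<noteq> 0"
  have "(\<lambda>k. of_nat k * u k / L) \<longlonglongrightarrow> L / L"
    by (intro tendsto_divide lim tendsto_const L)
  then have "(\<lambda>k. Re (of_nat k * u k / L)) \<longlonglongrightarrow> 1"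
    using L tendsto_Re by fastforce
  then have "\<forall>\<^sub>F k in sequentially. 1 / 2 < Re (of_nat k * u k / L)"
    by (rule order_tendstoD) simp
  then have bound: "\<forall>\<^sub>F k in sequentially. norm (inverse (real k)) \<le> 2 * Re (u k / L)"
    using eventually_gt_at_top[of 0]
  proof eventually_elim
    case (elim k)
    have "Re (of_nat k * u k / L) = real k * Re (u k / L)"
      by (metis Re_complex_of_real Im_complex_of_real of_real_of_nat_eq mult_zero_left diff_zero
          times_complex.sel(1) times_divide_eq_right)
    with elim show ?case
      by (simp add: field_simps)
  qed
  have "summable (\<lambda>k. 2 * Re (u k / L))"
    by (intro summable_mult summable_Re summable_divide assms)
  from summable_comparison_test_ev[OF bound this] show False
    using not_summable_harmonic[where 'a = real] by simp
qed

lemma f_term_Suc: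
  "f_term a b n (Suc k) =
     f_term a b n k * ((a + of_nat k) * (b + of_nat k) / ((n + of_nat k) * (2 * n + of_nat k)))"
  by (simp add: f_term_def pochhammer_Suc mult_ac)

lemma f_term_shift:
  assumes "n \<notin> \<int>\<^sub>\<le>\<^sub>0" and "2 * n \<notin> \<int>\<^sub>\<le>\<^sub>0"
  shows "f_term a b (n + 1) k =
     f_term a b n k * (2 * n\<^sup>2 * (2 * n + 1)
       / ((n + of_nat k) * (2 * n + of_nat k) * (2 * n + of_nat k + 1)))"
proof -
  have nz: "n \<noteq> 0" "2 * n + 1 \<noteq> 0"
    "n + of_nat k \<noteq> 0" "2 * n + of_nat k \<noteq> 0" "2 * n + of_nat k + 1 \<noteq> 0"
    using assms plus_of_nat_eq_0_imp[of n k]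
      plus_of_nat_eq_0_imp[of "2 * n" k]
      plus_of_nat_eq_0_imp[of "2 * n" "Suc k"]
      plus_of_nat_eq_0_imp[of "2 * n" "Suc 0"]
    by (auto simp: add_ac)
  have "pochhammer n (Suc k) = n * pochhammer (n + 1) k"
    by (rule pochhammer_rec)
  then have p: "pochhammer (n + 1) k = pochhammer n k * (n + of_nat k) / n"
    using nz by (simp add: pochhammer_Suc field_simps)
  have "pochhammer (2 * n) (Suc (Suc k)) = 2 * n * ((2 * n + 1) * pochhammer (2 * n + 1 + 1) k)"
    by (simp only: pochhammer_rec)
  then have q: "pochhammer (2 * (n + 1)) k =
      pochhammer (2 * n) k * ((2 * n + of_nat k) * (2 * n + of_nat k + 1)) / (2 * n * (2 * n + 1))"
    using no_zero_divisors[of "2 * n" "2 * n + 1"] nz(1,2)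
    by (subst nonzero_eq_divide_eq) (simp, simp add: pochhammer_Suc mult_ac add_ac)
  show ?thesis
    unfolding f_term_def p q using nz by (simp add: power2_eq_square mult_ac)
qed

text \<open>
  The numerator \<open>P\<close> of the certificate, obtained by solving the linear system for its coefficients
  from the top degree downwards. The constant coefficient is written through \<open>g1\<close> because the
  boundary term \<open>P 0 / (2n)\<close> has to be \<open>- g1\<close>.
\<close>
definition gosper_poly :: "complex \<Rightarrow> complex \<Rightarrow> complex \<Rightarrow> complex \<Rightarrow> complex" where
  "gosper_poly a b n x =
     x\<^sup>2 / (a + b - 3 * n + 1)
     + ((5 * n + 1) * (a + b - 3 * n + 1) - (a * b + 2 * (a + b) + 1 - n * (2 * n + 1)))
         / ((a + b - 3 * n + 1) * (a + b - 3 * n)) * x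
     - 2 * n * g1 a b n"

text \<open>
  At \<open>x = k\<close>, multiplying both sides by \<open>t k / ((n + k) (2n + k) (2n + k + 1))\<close> turns this into the
  telescoping relation \<open>G (k + 1) - G k = t k - g2 * t' k\<close>.
  After clearing the three linear factors in \<open>a + b - 3n\<close> it is a polynomial identity.
\<close>
lemma gosper_equation:
  assumes D: "(a + b - 3 * n - 1) * (a + b - 3 * n) * (a + b - 3 * n + 1) \<noteq> 0"
    and n: "n \<noteq> 0" "2 * n + 1 \<noteq> 0"
  shows "gosper_poly a b n (x + 1) * (a + x) * (b + x)
           - gosper_poly a b n x * (n + x) * (2 * n + x + 1)
         = (n + x) * (2 * n + x) * (2 * n + x + 1) - g2 a b n * (2 * n\<^sup>2 * (2 * n + 1))"
proof -
  define s where "s = a + b - 3 * n"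
  have s: "s \<noteq> 0" "s + 1 \<noteq> 0" "s - 1 \<noteq> 0"
    using D by (auto simp: s_def)
  have b: "b = s + 3 * n - a"
    by (simp add: s_def)
  define q where "q = (5 * n + 1) * (s + 1) - (a * b + 2 * (a + b) + 1 - n * (2 * n + 1))"
  define c where "c = (a - 2 * n - 1) * (a - 2 * n) * (a - n) * (b - 2 * n - 1) * (b - 2 * n) * (b - n)"
  have P: "gosper_poly a b n y = (y\<^sup>2 * s * (s - 1) + q * (s - 1) * y + N a b n) / ((s - 1) * s * (s + 1))" for y
    using s n unfolding gosper_poly_def g1_def s_def[symmetric] q_def[symmetric]
    by (simp add: divide_simps) (simp add: algebra_simps power2_eq_square)
  have C: "g2 a b n * (2 * n\<^sup>2 * (2 * n + 1)) = - c / ((s - 1) * s * (s + 1))"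
    using s n unfolding g2_def s_def[symmetric] c_def[symmetric] by (simp add: divide_simps)
  have "((x + 1)\<^sup>2 * s * (s - 1) + q * (s - 1) * (x + 1) + N a b n) * (a + x) * (b + x)
      - (x\<^sup>2 * s * (s - 1) + q * (s - 1) * x + N a b n) * (n + x) * (2 * n + x + 1)
      = (n + x) * (2 * n + x) * (2 * n + x + 1) * ((s - 1) * s * (s + 1)) + c"
    unfolding N_def c_def q_def b by algebra
  then show ?thesis
    unfolding P C using s by (simp add: divide_simps)
qed

text \<open>
  The limit of \<open>R k / k\<close> is the leading coefficient of \<open>P\<close>. That it is nonzero is what allows
  convergence of \<open>G\<close> to be carried over to \<open>k * t k\<close>.
\<close>
lemma gosper_poly_asymptotics:
  assumes "a + b - 3 * n + 1 \<noteq> 0"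
    and nz: "\<And>k. 2 * n + of_nat k \<noteq> 0"
  shows "(\<lambda>k. gosper_poly a b n (of_nat k) / (of_nat k * (2 * n + of_nat k)))
           \<longlonglongrightarrow> 1 / (a + b - 3 * n + 1)"
proof -
  define p where "p = a + b - 3 * n + 1"
  define q where "q = ((5 * n + 1) * (a + b - 3 * n + 1)
        - (a * b + 2 * (a + b) + 1 - n * (2 * n + 1)))
      / ((a + b - 3 * n + 1) * (a + b - 3 * n))"
  define r where "r = 2 * n * g1 a b n"
  define R where "R k = (1 / p + q * inverse (of_nat k) - r * inverse (of_nat k) * inverse (of_nat k))
       / (2 * n * inverse (of_nat k) + 1)" for k
  have p: "p \<noteq> 0"
    using assms(1) by (simp add: p_def)
  have inv: "(\<lambda>k. inverse (of_nat k :: complex)) \<longlonglongrightarrow> 0"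
    by (rule lim_inverse_n)
  have "R \<longlonglongrightarrow> (1 / p + q * 0 - r * 0 * 0) / (2 * n * 0 + 1)"
    unfolding R_def by (intro tendsto_intros inv) simp
  then have "R \<longlonglongrightarrow> 1 / p"
    by simp
  moreover have "\<forall>\<^sub>F k in sequentially.
      R k = gosper_poly a b n (of_nat k) / (of_nat k * (2 * n + of_nat k))"
    using eventually_gt_at_top[of 0]
  proof eventually_elim
    case (elim k)
    define y where "y = (of_nat k :: complex)"
    have y: "y \<noteq> 0" "2 * n + y \<noteq> 0"
      using elim nz[of k] by (auto simp: y_def)
    have P: "gosper_poly a b n y = y\<^sup>2 / p + q * y - r"
      by (simp add: gosper_poly_def p_def q_def r_def)
    have "1 / p + q * inverse y - r * inverse y * inverse y = (y\<^sup>2 / p + q * y - r) / y\<^sup>2"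
      using y by (simp add: field_simps power2_eq_square)
    moreover have "2 * n * inverse y + 1 = (2 * n + y) / y"
      using y by (simp add: field_simps)
    ultimately show ?case
      unfolding R_def y_def[symmetric] P using y by (simp add: power2_eq_square)
  qed
  ultimately show ?thesis
    unfolding p_def by (rule Lim_transform_eventually)
qed

theorem theorem4p12:
  fixes a b n :: complex
  assumes "n \<notin> \<int>\<^sub>\<le>\<^sub>0" and "2 * n \<notin> \<int>\<^sub>\<le>\<^sub>0"
    and "summable (f_term a b n)" and "summable (f_term a b (n + 1))"
    and "(a + b - 3 * n - 1) * (a + b - 3 * n) * (a + b - 3 * n + 1) \<noteq> 0"
  shows "f a b n = g1 a b n + g2 a b n * f a b (n + 1)"
proof -
  define G where "G k = gosper_poly a b n (of_nat k) / (2 * n + of_nat k) * f_term a b n k" for k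
  have n0: "n + of_nat k \<noteq> 0" "2 * n + of_nat k \<noteq> 0" for k
    using assms plus_of_nat_eq_0_imp by blast+
  have n: "n \<noteq> 0" "2 * n + 1 \<noteq> 0"
    using n0(1)[of 0] n0(2)[of 1] by auto
  have step: "G (Suc k) - G k = f_term a b n k - g2 a b n * f_term a b (n + 1) k" for k
  proof -
    define x where "x = (of_nat k :: complex)"
    have nz: "n + x \<noteq> 0" "2 * n + x \<noteq> 0" "2 * n + x + 1 \<noteq> 0"
      using n0[of k] n0(2)[of "Suc k"] by (auto simp: x_def add_ac)
    have x1: "of_nat (Suc k) = x + 1"
      by (simp add: x_def)
    have "G (Suc k) - G k = f_term a b n k *
        ((gosper_poly a b n (x + 1) * (a + x) * (b + x)
           - gosper_poly a b n x * (n + x) * (2 * n + x + 1))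
         / ((n + x) * (2 * n + x) * (2 * n + x + 1)))"
      unfolding G_def x1 f_term_Suc x_def[symmetric] using nz
      by (simp add: divide_simps) (simp add: algebra_simps)
    also have "\<dots> = f_term a b n k - g2 a b n * f_term a b (n + 1) k"
      unfolding gosper_equation[OF assms(5) n] f_term_shift[OF assms(1,2)] x_def[symmetric]
      using nz by (simp add: diff_divide_distrib right_diff_distrib)
    finally show ?thesis .
  qed
  define L where "L = f a b n - g2 a b n * f a b (n + 1) + G 0"
  have "(\<lambda>k. G (Suc k) - G k) sums (f a b n - g2 a b n * f a b (n + 1))"
    unfolding step f_def by (intro sums_diff sums_mult summable_sums assms)
  then have "(\<lambda>m. G m - G 0) \<longlonglongrightarrow> L - G 0"
    by (simp add: sums_def sum_lessThan_telescope L_def)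
  from tendsto_add[OF this tendsto_const[of "G 0"]] have lim: "G \<longlonglongrightarrow> L"
    by simp
  have "L = 0"
  proof -
    \<comment> \<open>The factor between \<open>k * t k\<close> and \<open>G k\<close>.\<close>
    define Q where "Q k = gosper_poly a b n (of_nat k) / (of_nat k * (2 * n + of_nat k))" for k
    define c where "c = 1 / (a + b - 3 * n + 1)"
    have c: "c \<noteq> 0"
      using assms(5) by (simp add: c_def)
    have Q: "Q \<longlonglongrightarrow> c"
      unfolding Q_def c_def using assms(5) n0(2) by (intro gosper_poly_asymptotics) auto
    have "\<forall>\<^sub>F k in sequentially. Q k \<noteq> 0"
      using Q c by (rule tendsto_imp_eventually_ne)
    then have "\<forall>\<^sub>F k in sequentially. G k / Q k = of_nat k * f_term a b n k"
      by eventually_elim (auto simp: G_def Q_def)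
    moreover have "(\<lambda>k. G k / Q k) \<longlonglongrightarrow> L / c"
      using c by (intro tendsto_divide lim Q)
    ultimately have "(\<lambda>k. of_nat k * f_term a b n k) \<longlonglongrightarrow> L / c"
      by (rule Lim_transform_eventually[rotated])
    from summable_imp_lim_n_mult_eq_0[OF assms(3) this] show ?thesis
      using c by simp
  qed
  moreover have "G 0 = - g1 a b n"
    using n by (simp add: G_def gosper_poly_def f_term_def)
  ultimately show ?thesis
    by (simp add: L_def algebra_simps)
qed

end
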